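(* Consider the affine lines in $\mathbb{R}^2$ $$Y_0:\ y=0,\qquad L_i:\ y=m_i(x-a_i),\quad i=1,\dots,18,$$ where $\varepsilon$ is a real parameter and $a_1=-\tan(8\pi/18)$, $a_2=-\tan(4\pi/18)$, $a_3=-\tan(6\pi/18)$, $a_4=\tan(7\pi/18)$, $a_5=\tan(\pi/18)$, $a_6=\tan(5\pi/18)$, $a_7=-\tan(5\pi/18)$, $a_8=-\varepsilon$, $a_9=-\tan(2\pi/18)$, $a_{10}=\tan(3\pi/18)$, $a_{11}=-\tan(7\pi/18)$, $a_{12}=-\tan(3\pi/18)$, $a_{13}=\tan(2\pi/18)$, $a_{14}=\tan(4\pi/18)$, $a_{15}=\varepsilon$, $a_{16}=\tan(6\pi/18)$, $a_{17}=-\tan(\pi/18)$, $a_{18}=\tan(8\pi/18)$, and $m_i\in[m_i^\ast-10^{-4},\,m_i^\ast+10^{-4}]$ with $m_1^\ast=-0.18006$, $m_2^\ast=-0.25231$, $m_3^\ast=-0.32584$, $m_4^\ast=-1.74521$, $m_5^\ast=-2.17941$, $m_6^\ast=-2.79557$, $m_7^\ast=-4.59586$, $m_8^\ast=-5.67203$, $m_9^\ast=-7.39905$, $m_{10}^\ast=-23.07892$, $m_{11}^\ast=4.39005$, $m_{12}^\ast=2.90204$, $m_{13}^\ast=1.31845$, $m_{14}^\ast=0.90192$, $m_{15}^\ast=0.84501$, $m_{16}^\ast=0.64068$, $m_{17}^\ast=0.44393$, $m_{18}^\ast=0.15548$. Then for every $\varepsilon\in(0,10^{-4})$ and every choice of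 slopes $m_i$ in these intervals, $\{Y_0,L_1,\dots,L_{18}\}$ is a simple affine arrangement of $19$ straight lines such that: (1) $Y_0$ is the line $y=0$; (2) each $L_i$ has the form $y=m_i(x-a_i)$; (3) $\{a_1,\dots,a_{18}\}=\{\pm\tan(k\pi/18)\mid k=1,\dots,8\}\cup\{-\varepsilon,+\varepsilon\}$, with $\varepsilon<1/36$; (4) $Y_0$ touches exactly $17$ bounded triangular faces of the arrangement; (5) the arrangement has exactly $107$ bounded triangular faces.
   Context: An arrangement of lines is simple if no two lines are parallel and no point lies on more than two of its lines. A line $Y_0$ touches a bounded triangular face if it contains one of the sides of that triangle. *)

theory Defs
  imports "HOL-Analysis.Analysis"
begin

type_synonym plane = "real \<times> real"

definition is_line :: "plane set \<Rightarrow> bool" where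
  "is_line l \<longleftrightarrow> affine l \<and> aff_dim l = 1"

definition line_arrangement :: "plane set set \<Rightarrow> bool" where
  "line_arrangement A \<longleftrightarrow> finite A \<and> (\<forall>l\<in>A. is_line l)"

definition simple_arrangement :: "plane set set \<Rightarrow> bool" where
  "simple_arrangement A \<longleftrightarrow> line_arrangement A
     \<and> (\<forall>l\<in>A. \<forall>l'\<in>A. l \<noteq> l' \<longrightarrow> \<not> affine_parallel l l')
     \<and> (\<forall>p. card {l \<in> A. p \<in> l} \<le> 2)"

definition faces :: "plane set set \<Rightarrow> plane set set" where
  "faces A = components (- \<Union>A)"

text \<open>A face is an open set; it is a triangle if its closure is a non-degenerate closed triangle,
  i.e. a 2-simplex. The sides of the triangle are then the facets of the closure.\<close>

definition bounded_triangular_faces :: "plane set set \<Rightarrow> plane set set" where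
  "bounded_triangular_faces A = {F \<in> faces A. bounded F \<and> 2 simplex closure F}"

definition touches :: "plane set \<Rightarrow> plane set \<Rightarrow> bool" where
  "touches l F \<longleftrightarrow> (\<exists>s. s facet_of closure F \<and> s \<subseteq> l)"

text \<open>The two lists below are indexed from 0, hence the shift: \<open>intercept \<epsilon> i\<close> is $a_i$ and
  \<open>slope_center i\<close> is $m_i^*$ for $i = 1, \dots, 18$.\<close>

definition intercept :: "real \<Rightarrow> nat \<Rightarrow> real" where
  "intercept \<epsilon> i =
    [- tan (8 * pi / 18), - tan (4 * pi / 18), - tan (6 * pi / 18),
     tan (7 * pi / 18), tan (pi / 18), tan (5 * pi / 18),
     - tan (5 * pi / 18), - \<epsilon>, - tan (2 * pi / 18),
     tan (3 * pi / 18), - tan (7 * pi / 18), - tan (3 * pi / 18),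
     tan (2 * pi / 18), tan (4 * pi / 18), \<epsilon>,
     tan (6 * pi / 18), - tan (pi / 18), tan (8 * pi / 18)] ! (i - 1)"

definition slope_center :: "nat \<Rightarrow> real" where
  "slope_center i =
    [- 0.18006, - 0.25231, - 0.32584, - 1.74521, - 2.17941, - 2.79557,
     - 4.59586, - 5.67203, - 7.39905, - 23.07892, 4.39005, 2.90204,
     1.31845, 0.90192, 0.84501, 0.64068, 0.44393, 0.15548] ! (i - 1)"

definition Y0 :: "plane set" where
  "Y0 = {(x, y). y = 0}"

definition L :: "real \<Rightarrow> (nat \<Rightarrow> real) \<Rightarrow> nat \<Rightarrow> plane set" where
  "L \<epsilon> m i = {(x, y). y = m i * (x - intercept \<epsilon> i)}"

definition arrangement :: "real \<Rightarrow> (nat \<Rightarrow> real) \<Rightarrow> plane set set" where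
  "arrangement \<epsilon> m = insert Y0 (L \<epsilon> m ` {1..18})"

end

theory Submission
  imports Defs
begin

text \<open>In a simple arrangement, three lines bound a triangular face iff no fourth line crosses the
  triangle they span, that is, iff on each of the three lines the crossings with the other two are
  consecutive. Hence the triangular faces are determined by the order in which every line meets the
  others. For the given parameters each of these order relations is the sign of a polynomial in the
  slopes and intercepts, and integer interval arithmetic over the whole parameter box decides it. The
  only exception is the triangle of \<open>Y\<^sub>0\<close> with the two lines through \<open>\<plusminus>\<epsilon>\<close>, which degenerates as
  \<open>\<epsilon>\<close> tends to \<open>0\<close>; there the sign is read off directly.\<close>

section \<open>Triangular faces of a simple arrangement\<close>

text \<open>No line is vertical, so the order along each line is the order of abscissas. Multiplying
  a difference of two crossings on line \<open>i\<close> by the squares of its denominators gives a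
  polynomial whose positivity certifies two things at once: the strict order, and that line
  \<open>i\<close> is parallel to neither of the other two. Hence a single list of signs yields
  distinct slopes, absence of triple points and the combinatorics. Only neighbours in a row have to
  be compared, 19 rows with 17 pairs each; transitivity supplies the other comparisons.

  Faces are never enumerated. A triangular face is identified with the set of three lines that
  contain its sides, and such sets are counted by their least index. Since \<open>Y0\<close> has
  index 0, the faces touching it form the first summand of the total.\<close>

locale line_family =
  fixes I :: "'i set" and s t :: "'i \<Rightarrow> real"
  assumes finite_I: "finite I"
    and inj_slope: "inj_on s I"
begin

definition height :: "'i \<Rightarrow> plane \<Rightarrow> real" where
  "height i z = snd z - (s i * fst z + t i)"

definition line :: "'i \<Rightarrow> plane set" where
  "line i = {z. height i z = 0}"

definition crossing :: "'i \<Rightarrow> 'i \<Rightarrow> real" where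
  "crossing i j = (t j - t i) / (s i - s j)"

definition vertex :: "'i \<Rightarrow> 'i \<Rightarrow> plane" where
  "vertex i j = (crossing i j, s i * crossing i j + t i)"

text \<open>The product says "strictly on the same side as \<open>p\<close>" without a case
  distinction; if \<open>p\<close> lies on one of the lines, the cell is empty.\<close>

definition cell :: "plane \<Rightarrow> plane set" where
  "cell p = {z. \<forall>i\<in>I. 0 < height i z * height i p}"

text \<open>\<open>j\<close> and \<open>k\<close> run through both orders, so one chain of strict
  inequalities excludes \<open>l\<close> from lying between them on either side.\<close>

definition empty_triples :: "'i set set" where
  "empty_triples = {S. S \<subseteq> I \<and> card S = 3 \<and>
     (\<forall>i\<in>S. \<forall>j\<in>S - {i}. \<forall>k\<in>S - {i}. \<forall>l\<in>I - S.
        \<not> (crossing i j < crossing i l \<and> crossing i l < crossing i k))}"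

definition touching :: "plane set \<Rightarrow> 'i set" where
  "touching F = {i \<in> I. touches (line i) F}"

text \<open>Intended inverse of \<open>touching\<close>. Taking all vertices of the set avoids
  choosing an order of its three lines.\<close>

definition triangle :: "'i set \<Rightarrow> plane set" where
  "triangle S = interior (convex hull {vertex i j | i j. i \<in> S \<and> j \<in> S \<and> i \<noteq> j})"

lemma slope_neq: "i \<in> I \<Longrightarrow> j \<in> I \<Longrightarrow> i \<noteq> j \<Longrightarrow> s i \<noteq> s j"
  using inj_slope by (auto dest: inj_onD)

lemma height_affine:
  "u + v = 1 \<Longrightarrow> height i (u *\<^sub>R z + v *\<^sub>R w) = u * height i z + v * height i w"
  by (simp add: height_def algebra_simps) (metis distrib_left mult.commute mult.right_neutral)

lemma height_affine3:
  assumes "u + v + w = 1"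
  shows "height i (u *\<^sub>R a + v *\<^sub>R b + w *\<^sub>R c) = u * height i a + v * height i b + w * height i c"
proof -
  have "t i = u * t i + v * t i + w * t i"
    using assms by (metis distrib_right mult_1)
  then show ?thesis by (simp add: height_def algebra_simps)
qed

lemma continuous_on_height: "continuous_on A (height i)"
  unfolding height_def by (intro continuous_intros)

lemma line_eq_hyperplane: "line i = {z. (- s i, 1) \<bullet> z = t i}"
  by (auto simp: line_def height_def)

lemma is_line_line: "is_line (line i)"
  unfolding is_line_def line_eq_hyperplane by (simp add: affine_hyperplane zero_prod_def)

lemma affine_line: "affine (line i)"
  using is_line_line by (simp add: is_line_def)

lemma closed_line: "closed (line i)"
  unfolding line_eq_hyperplane by (rule closed_hyperplane)

lemma mem_two_lines:
  assumes "i \<in> I" "j \<in> I" "i \<noteq> j"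
  shows "z \<in> line i \<and> z \<in> line j \<longleftrightarrow> z = vertex i j"
proof -
  have c: "x = crossing i j \<longleftrightarrow> s i * x + t i = s j * x + t j" for x
    using slope_neq[OF assms] by (auto simp: crossing_def field_simps)
  show ?thesis
    using c[of "fst z"] by (cases z) (auto simp: line_def height_def vertex_def)
qed

lemma vertex_in_line:
  assumes "i \<in> I" "j \<in> I" "i \<noteq> j"
  shows "vertex i j \<in> line i" "vertex i j \<in> line j"
  using mem_two_lines[OF assms] by blast+

lemma inj_on_line: "inj_on line I"
proof (rule inj_onI, rule ccontr)
  fix i j assume ij: "i \<in> I" "j \<in> I" "line i = line j" "i \<noteq> j"
  have "(0, t i) \<in> line i" "(1, s i + t i) \<in> line i" by (simp_all add: line_def height_def)
  then show False using mem_two_lines[OF ij(1,2,4)] ij(3) by (metis prod.inject zero_neq_one)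
qed

lemma not_parallel:
  assumes "i \<in> I" "j \<in> I" "i \<noteq> j"
  shows "\<not> affine_parallel (line i) (line j)"
proof
  assume "affine_parallel (line i) (line j)"
  then obtain a where a: "line j = (\<lambda>x. a + x) ` line i" by (auto simp: affine_parallel_def)
  have "(0, t i) \<in> line i" "(1, s i + t i) \<in> line i" by (simp_all add: line_def height_def)
  then have "a + (0, t i) \<in> line j" "a + (1, s i + t i) \<in> line j" using a by auto
  then have "s i = s j" by (simp add: line_def height_def algebra_simps)
  then show False using slope_neq assms by blast
qed

lemma vertex_commute:
  assumes "i \<in> I" "j \<in> I" "i \<noteq> j"
  shows "vertex i j = vertex j i"
  using mem_two_lines[OF assms] mem_two_lines[of j i] assms by blast

text \<open>Along line \<open>i\<close>, the height over line \<open>l\<close> is an affine function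
  of the abscissa with slope \<open>s i - s l\<close> and zero at \<open>crossing i l\<close>. This
  turns sides of lines into orders of crossings.\<close>

lemma height_vertex:
  assumes "i \<in> I" "l \<in> I" "i \<noteq> l"
  shows "height l (vertex i j) = (s i - s l) * (crossing i j - crossing i l)"
proof -
  have "(s i - s l) * crossing i l = t l - t i"
    using slope_neq[OF assms] by (simp add: crossing_def)
  then show ?thesis by (simp add: height_def vertex_def algebra_simps)
qed

section \<open>Faces as cells of constant sign of the height functions\<close>

lemma convex_cell: "convex (cell p)"
proof (rule convexI)
  fix x y and u v :: real
  assume h: "x \<in> cell p" "y \<in> cell p" "0 \<le> u" "0 \<le> v" "u + v = 1"
  show "u *\<^sub>R x + v *\<^sub>R y \<in> cell p"
    unfolding cell_def
  proof safe
    fix i assume i: "i \<in> I"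
    have "0 < height i x * height i p" "0 < height i y * height i p" using h i by (auto simp: cell_def)
    then have "0 < u * (height i x * height i p) + v * (height i y * height i p)"
      using h(3,4,5) by (cases "u = 0") (auto simp: add_pos_nonneg)
    then show "0 < height i (u *\<^sub>R x + v *\<^sub>R y) * height i p"
      by (simp add: height_affine[OF h(5)] algebra_simps)
  qed
qed

lemma connected_height_same_sign:
  assumes "connected C" "x \<in> C" "y \<in> C" "C \<inter> line i = {}"
  shows "0 < height i x * height i y"
proof (rule ccontr)
  assume neg: "\<not> ?thesis"
  have "connected (height i ` C)"
    using assms(1) continuous_on_height by (rule connected_continuous_image[rotated])
  then have iv: "is_interval (height i ` C)" by (simp add: is_interval_connected_1)
  have "height i x \<le> 0 \<and> 0 \<le> height i y \<or> height i y \<le> 0 \<and> 0 \<le> height i x"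
    using neg by (auto simp: zero_less_mult_iff)
  then have "0 \<in> height i ` C"
    using iv assms(2,3) unfolding is_interval_1 by blast
  then show False using assms(4) by (auto simp: line_def)
qed

lemma cell_disjoint_lines: "cell p \<inter> \<Union>(line ` I) = {}"
  by (auto simp: cell_def line_def)

text \<open>A component misses every line, so no height changes sign on it; conversely a cell is
  convex, hence connected, and misses every line.\<close>

lemma faces_eq_cells: "faces (line ` I) = cell ` (- \<Union>(line ` I))"
proof -
  have "connected_component_set (- \<Union>(line ` I)) p = cell p" if p: "p \<notin> \<Union>(line ` I)" for p
  proof
    show "connected_component_set (- \<Union>(line ` I)) p \<subseteq> cell p"
    proof
      fix z assume z: "z \<in> connected_component_set (- \<Union>(line ` I)) p"
      let ?C = "connected_component_set (- \<Union>(line ` I)) p"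
      have sub: "?C \<subseteq> - \<Union>(line ` I)" by (rule connected_component_subset)
      have "p \<in> ?C" using p by (simp add: connected_component_refl)
      then have "0 < height i z * height i p" if "i \<in> I" for i
        using z sub that by (intro connected_height_same_sign[of ?C]) auto
      then show "z \<in> cell p" by (auto simp: cell_def)
    qed
    have "p \<in> cell p"
      using p by (auto simp: cell_def line_def zero_less_mult_iff linorder_neq_iff)
    then show "cell p \<subseteq> connected_component_set (- \<Union>(line ` I)) p"
      using cell_disjoint_lines[of p] convex_connected[OF convex_cell[of p]]
      by (intro connected_component_maximal) auto
  qed
  then show ?thesis unfolding faces_def components_def by (intro image_cong) auto
qed

lemma open_face: "F \<in> faces (line ` I) \<Longrightarrow> open F"
  unfolding faces_def
  by (rule open_components[rotated]) (auto intro!: open_Compl closed_UN finite_I closed_line)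

lemma convex_face: "F \<in> faces (line ` I) \<Longrightarrow> convex F"
  using convex_cell by (auto simp: faces_eq_cells)

lemma interior_closure_face: "F \<in> faces (line ` I) \<Longrightarrow> interior (closure F) = F"
  by (simp add: convex_interior_closure convex_face open_face interior_open)

text \<open>The inequalities defining a cell survive weakly in the closure, and off the lines they
  become strict again. Hence the boundary of a face is covered by the lines.\<close>

lemma closure_face_subset:
  assumes "F \<in> faces (line ` I)"
  shows "closure F \<subseteq> F \<union> \<Union>(line ` I)"
proof
  fix z assume z: "z \<in> closure F"
  obtain p where F: "F = cell p" using assms by (auto simp: faces_eq_cells)
  have "0 \<le> height i z * height i p" if "i \<in> I" for i
  proof -
    have "closed {z. 0 \<le> height i z * height i p}"
      by (intro closed_Collect_le continuous_intros continuous_on_height)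
    moreover have "F \<subseteq> {z. 0 \<le> height i z * height i p}"
      using that by (auto simp: F cell_def intro: less_imp_le)
    ultimately have "closure F \<subseteq> {z. 0 \<le> height i z * height i p}" by (rule closure_minimal[rotated])
    then show ?thesis using z by auto
  qed
  moreover have "height i p \<noteq> 0" if "i \<in> I" for i
  proof
    assume "height i p = 0"
    then have "F = {}" using that by (auto simp: F cell_def intro!: bexI[of _ i])
    then show False using z by simp
  qed
  ultimately have "z \<in> F" if "z \<notin> \<Union>(line ` I)"
    using that unfolding F cell_def line_def
    by (smt (verit) UN_I mem_Collect_eq mult_eq_0_iff)
  then show "z \<in> F \<union> \<Union>(line ` I)" by blast
qed

text \<open>Finitely many lines cover infinitely many points, so one of them contains two points of
  the segment. The height is affine along the segment and vanishes at two parameters, hence also at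
  both ends.\<close>

lemma segment_in_line:
  assumes "closed_segment q r \<subseteq> \<Union>(line ` I)" "q \<noteq> r"
  shows "\<exists>i\<in>I. {q, r} \<subseteq> line i"
proof -
  have "infinite (closed_segment q r)"
    using uncountable_closed_segment[OF assms(2)] countable_finite by blast
  moreover have "closed_segment q r = (\<Union>i\<in>I. closed_segment q r \<inter> line i)" using assms(1) by auto
  ultimately obtain i where i: "i \<in> I" "infinite (closed_segment q r \<inter> line i)"
    using finite_I by (metis finite_UN_I)
  then obtain x where x: "x \<in> closed_segment q r \<inter> line i" using infinite_imp_nonempty by blast
  have "infinite (closed_segment q r \<inter> line i - {x})" using i(2) by simp
  then obtain y where y: "y \<in> closed_segment q r \<inter> line i - {x}" using infinite_imp_nonempty by blast
  have xy: "x \<in> closed_segment q r" "y \<in> closed_segment q r" "x \<in> line i" "y \<in> line i" "x \<noteq> y"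
    using x y by auto
  obtain u v where u: "x = (1 - u) *\<^sub>R q + u *\<^sub>R r" and v: "y = (1 - v) *\<^sub>R q + v *\<^sub>R r"
    using xy by (auto simp: closed_segment_def)
  have uv: "u \<noteq> v" using u v xy by auto
  have 1: "(1 - u) * height i q + u * height i r = 0" and 2: "(1 - v) * height i q + v * height i r = 0"
    using xy(3,4) unfolding u v line_def by (auto simp: height_affine)
  have "(u - v) * (height i r - height i q) = 0" using 1 2 by (simp add: algebra_simps)
  then have "height i r = height i q" using uv by simp
  then have "height i r = 0" "height i q = 0" using 1 by (auto simp: algebra_simps)
  then show ?thesis using i by (auto simp: line_def)
qed
end

section \<open>Triangular faces correspond to triples with consecutive crossings\<close>

locale simple_line_family = line_family +
  assumes crossing_neq:
    "i \<in> I \<Longrightarrow> j \<in> I \<Longrightarrow> k \<in> I \<Longrightarrow> i \<noteq> j \<Longrightarrow> i \<noteq> k \<Longrightarrow> j \<noteq> k \<Longrightarrow> crossing i j \<noteq> crossing i k"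
begin

lemma simple_arrangement_lines: "simple_arrangement (line ` I)"
proof -
  have "card {l \<in> line ` I. p \<in> l} \<le> 2" for p
  proof (rule ccontr)
    assume "\<not> ?thesis"
    moreover have "{l \<in> line ` I. p \<in> l} = line ` {i \<in> I. p \<in> line i}" by auto
    ultimately have "3 \<le> card {i \<in> I. p \<in> line i}"
      using card_image_le[of "{i \<in> I. p \<in> line i}" line] finite_I by simp
    then obtain S where "S \<subseteq> {i \<in> I. p \<in> line i}" "card S = 3"
      by (meson obtain_subset_with_card_n)
    then obtain i j k where ijk: "{i, j, k} \<subseteq> {i \<in> I. p \<in> line i}" "i \<noteq> j" "i \<noteq> k" "j \<noteq> k"
      by (auto simp: card_3_iff)
    then have "p = vertex i j" "p = vertex i k"
      using mem_two_lines[of i j p] mem_two_lines[of i k p] by auto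
    then have "crossing i j = crossing i k" by (simp add: vertex_def)
    then show False using crossing_neq ijk by auto
  qed
  moreover have "\<not> affine_parallel l l'" if "l \<in> line ` I" "l' \<in> line ` I" "l \<noteq> l'" for l l'
    using that not_parallel by blast
  ultimately show ?thesis
    unfolding simple_arrangement_def line_arrangement_def
    using finite_I is_line_line by blast
qed

lemma vertex_not_in_line:
  assumes "i \<in> I" "j \<in> I" "k \<in> I" "i \<noteq> j" "i \<noteq> k" "j \<noteq> k"
  shows "vertex i j \<notin> line k"
  using height_vertex[of i k j] crossing_neq[of i j k] slope_neq[of i k] assms by (simp add: line_def)

lemma height_same_sign_iff:
  assumes "i \<in> I" "j \<in> I" "k \<in> I" "l \<in> I" "i \<noteq> j" "i \<noteq> k" "l \<noteq> i" "l \<noteq> j" "l \<noteq> k"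
  shows "0 < height l (vertex i j) * height l (vertex i k) \<longleftrightarrow>
     \<not> (crossing i j < crossing i l \<and> crossing i l < crossing i k) \<and>
     \<not> (crossing i k < crossing i l \<and> crossing i l < crossing i j)"
proof -
  have "height l (vertex i j) * height l (vertex i k) =
     (s i - s l)\<^sup>2 * ((crossing i j - crossing i l) * (crossing i k - crossing i l))"
    using assms by (simp add: height_vertex power2_eq_square)
  moreover have "0 < (s i - s l)\<^sup>2" using slope_neq[of i l] assms by simp
  ultimately have "0 < height l (vertex i j) * height l (vertex i k) \<longleftrightarrow>
     0 < (crossing i j - crossing i l) * (crossing i k - crossing i l)"
    by (simp add: zero_less_mult_iff)
  moreover have "crossing i j \<noteq> crossing i l" "crossing i k \<noteq> crossing i l"
    using crossing_neq assms by auto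
  ultimately show ?thesis by (auto simp: zero_less_mult_iff)
qed

lemma vertices_eq:
  assumes "i \<in> I" "j \<in> I" "k \<in> I" "i \<noteq> j" "i \<noteq> k" "j \<noteq> k"
  shows "{vertex a b | a b. a \<in> {i, j, k} \<and> b \<in> {i, j, k} \<and> a \<noteq> b} = {vertex j k, vertex i k, vertex i j}"
  (is "?A = ?B")
proof
  show "?A \<subseteq> ?B"
    using vertex_commute[of i j] vertex_commute[of i k] vertex_commute[of j k] assms by auto
  show "?B \<subseteq> ?A" using assms(4-6) by blast
qed

text \<open>Any two of the vertices lie on a common line of the triple, so "no crossing in between"
  on the three lines says that no further line separates two vertices.\<close>

lemma empty_triple_iff:
  assumes "i \<in> I" "j \<in> I" "k \<in> I" "i \<noteq> j" "i \<noteq> k" "j \<noteq> k"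
  shows "{i, j, k} \<in> empty_triples \<longleftrightarrow>
    (\<forall>l\<in>I - {i, j, k}. 0 < height l (vertex i j) * height l (vertex i k) \<and>
       0 < height l (vertex i j) * height l (vertex j k) \<and>
       0 < height l (vertex i k) * height l (vertex j k))" (is "_ \<longleftrightarrow> ?R")
proof -
  have c: "card {i, j, k} = 3" using assms by simp
  have a: "0 < height l (vertex i j) * height l (vertex i k) \<longleftrightarrow>
     \<not> (crossing i j < crossing i l \<and> crossing i l < crossing i k) \<and>
     \<not> (crossing i k < crossing i l \<and> crossing i l < crossing i j)" if "l \<in> I - {i, j, k}" for l
    using assms that by (intro height_same_sign_iff) auto
  have b: "0 < height l (vertex i j) * height l (vertex j k) \<longleftrightarrow>
     \<not> (crossing j i < crossing j l \<and> crossing j l < crossing j k) \<and>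
     \<not> (crossing j k < crossing j l \<and> crossing j l < crossing j i)" if "l \<in> I - {i, j, k}" for l
    using assms that vertex_commute[of i j] by (simp add: height_same_sign_iff)
  have d: "0 < height l (vertex i k) * height l (vertex j k) \<longleftrightarrow>
     \<not> (crossing k i < crossing k l \<and> crossing k l < crossing k j) \<and>
     \<not> (crossing k j < crossing k l \<and> crossing k l < crossing k i)" if "l \<in> I - {i, j, k}" for l
    using assms that vertex_commute[of i k] vertex_commute[of j k] by (simp add: height_same_sign_iff)
  have "{i, j, k} \<in> empty_triples \<longleftrightarrow> (\<forall>l\<in>I - {i, j, k}. \<forall>a\<in>{i, j, k}. \<forall>b\<in>{i, j, k} - {a}. \<forall>c\<in>{i, j, k} - {a}.
        \<not> (crossing a b < crossing a l \<and> crossing a l < crossing a c))"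
    using assms c unfolding empty_triples_def by blast
  also have "\<dots> \<longleftrightarrow> ?R"
    using assms by (intro ball_cong refl) (auto simp: a b d insert_Diff_if)
  finally show ?thesis .
qed

text \<open>The facets of a simplex are the hulls of its vertices with one removed. A line contains
  such a side iff it contains both its ends, and two distinct points lie on only one line of the
  family.\<close>

lemma touching_triangle:
  assumes ijk: "i \<in> I" "j \<in> I" "k \<in> I" "i \<noteq> j" "i \<noteq> k" "j \<noteq> k"
    and ind: "\<not> affine_dependent {p, q, r}" "p \<noteq> q" "p \<noteq> r" "q \<noteq> r"
    and F: "closure F = convex hull {p, q, r}"
    and on: "{q, r} \<subseteq> line i" "{p, r} \<subseteq> line j" "{p, q} \<subseteq> line k"
  shows "touching F = {i, j, k}"
proof -
  have hull: "convex hull {a, b} \<subseteq> line l \<longleftrightarrow> {a, b} \<subseteq> line l" for a b l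
    using hull_minimal[of "{a, b}" "line l" convex] affine_imp_convex[OF affine_line]
      hull_subset[of "{a, b}" convex] by blast
  have T: "touches (line l) F \<longleftrightarrow> {q, r} \<subseteq> line l \<or> {p, r} \<subseteq> line l \<or> {p, q} \<subseteq> line l" for l
  proof -
    have ne: "convex hull ({p, q, r} - {u}) \<noteq> {}" for u
      using ind(2,3,4) unfolding convex_hull_eq_empty by blast
    have "touches (line l) F \<longleftrightarrow> (\<exists>u\<in>{p, q, r}. convex hull ({p, q, r} - {u}) \<subseteq> line l)"
      unfolding touches_def F facet_of_convex_hull_affine_independent[OF ind(1)]
      using ne by blast
    then show ?thesis using ind(2,3,4) hull by (auto simp: insert_Diff_if)
  qed
  have uniq: "l = l'" if "l \<in> I" "l' \<in> I" "{a, b} \<subseteq> line l" "{a, b} \<subseteq> line l'" "a \<noteq> b" for l l' a b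
    using that mem_two_lines[of l l'] by (metis insert_subset)
  have "l \<in> touching F \<longleftrightarrow> l \<in> {i, j, k}" for l
    using ijk on ind(2,3,4) uniq[of l i q r] uniq[of l j p r] uniq[of l k p q]
    unfolding touching_def by (auto simp: T)
  then show ?thesis by blast
qed

text \<open>Each side lies in the boundary of the face, hence in the union of the lines, hence in
  one line. A fourth line cannot separate the vertices, because it misses a connected set containing
  all three.\<close>

lemma bounded_triangular_face_imp:
  assumes F: "F \<in> bounded_triangular_faces (line ` I)"
  shows "touching F \<in> empty_triples \<and> F = triangle (touching F)"
proof -
  have face: "F \<in> faces (line ` I)" and "2 simplex closure F"
    using F by (auto simp: bounded_triangular_faces_def)
  then obtain C where C: "\<not> affine_dependent C" "card C = 3" "closure F = convex hull C"
    by (auto simp: simplex_def)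
  then obtain p q r where pqr: "C = {p, q, r}" "p \<noteq> q" "p \<noteq> r" "q \<noteq> r" by (auto simp: card_3_iff)
  have edge: "\<exists>i\<in>I. {a, b} \<subseteq> line i" if "c \<in> C" "C - {c} = {a, b}" "a \<noteq> b" for a b c
  proof -
    have fac: "(convex hull {a, b}) facet_of (closure F)"
      unfolding C(3) facet_of_convex_hull_affine_independent[OF C(1)]
      using that by (intro conjI exI[of _ c]) simp_all
    then have "convex hull {a, b} \<noteq> closure F" using facet_of_irrefl by metis
    then have "convex hull {a, b} \<inter> interior (closure F) = {}"
      using fac by (intro face_of_disjoint_interior facet_of_imp_face_of)
    then have "convex hull {a, b} \<inter> F = {}" using interior_closure_face[OF face] by simp
    moreover have "convex hull {a, b} \<subseteq> closure F" using fac by (rule facet_of_imp_subset)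
    ultimately have "closed_segment a b \<subseteq> \<Union>(line ` I)"
      using closure_face_subset[OF face] unfolding segment_convex_hull by blast
    then show ?thesis using segment_in_line that(3) by blast
  qed
  have "C - {p} = {q, r}" "C - {q} = {p, r}" "C - {r} = {p, q}" using pqr by auto
  then obtain i j k where on: "i \<in> I" "{q, r} \<subseteq> line i" "j \<in> I" "{p, r} \<subseteq> line j" "k \<in> I" "{p, q} \<subseteq> line k"
    using edge[of p q r] edge[of q p r] edge[of r p q] pqr by auto
  have noncol: "\<not> {p, q, r} \<subseteq> line l" for l
  proof
    assume "{p, q, r} \<subseteq> line l"
    then have "aff_dim {p, q, r} \<le> 1"
      using aff_dim_subset[of "{p, q, r}" "line l"] is_line_line[of l] by (simp add: is_line_def)
    then show False using aff_dim_affine_independent[OF C(1)] C(2) pqr(1) by simp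
  qed
  have neq: "i \<noteq> j" "i \<noteq> k" "j \<noteq> k" using noncol on by auto
  have v: "p = vertex j k" "q = vertex i k" "r = vertex i j"
    using mem_two_lines[of j k p] mem_two_lines[of i k q] mem_two_lines[of i j r] on neq by auto
  have T: "touching F = {i, j, k}"
    using on neq C pqr by (intro touching_triangle[of i j k p q r]) auto
  have "0 < height l x * height l y"
    if l: "l \<in> I - {i, j, k}" and xy: "x \<in> {p, q, r}" "y \<in> {p, q, r}" for l x y
  proof -
    \<comment> \<open>Adding points of the closure keeps a connected set connected.\<close>
    have "connected (F \<union> {p, q, r})"
      using convex_connected[OF convex_face[OF face]]
      by (rule connected_intermediate_closure) (use closure_subset[of F] in \<open>auto simp: C(3) pqr(1) hull_inc\<close>)
    moreover have "p \<notin> line l" "q \<notin> line l" "r \<notin> line l"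
      unfolding v using vertex_not_in_line[of j k l] vertex_not_in_line[of i k l] vertex_not_in_line[of i j l]
        l on neq by auto
    moreover have "F \<inter> line l = {}"
      using face l cell_disjoint_lines by (auto simp: faces_eq_cells)
    ultimately show ?thesis using xy by (intro connected_height_same_sign[of "F \<union> {p, q, r}"]) auto
  qed
  then have "{i, j, k} \<in> empty_triples"
    unfolding empty_triple_iff[OF on(1,3,5) neq] v[symmetric] by blast
  moreover have "F = triangle {i, j, k}"
    using vertices_eq[of i j k] on neq interior_closure_face[OF face] C(3)
    by (simp add: triangle_def pqr(1) v)
  ultimately show ?thesis using T by simp
qed

text \<open>The open triangle is the cell of its centroid. In barycentric coordinates the height
  over a side line is a multiple of a single coordinate; over any other line the three vertices have
  heights of one sign, as does every positive combination.\<close>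

lemma empty_triple_imp:
  assumes S: "S \<in> empty_triples"
  shows "triangle S \<in> bounded_triangular_faces (line ` I) \<and> touching (triangle S) = S"
proof -
  obtain i j k where ijk: "S = {i, j, k}" "i \<noteq> j" "i \<noteq> k" "j \<noteq> k"
    using S by (auto simp: empty_triples_def card_3_iff)
  have I: "i \<in> I" "j \<in> I" "k \<in> I" using S ijk by (auto simp: empty_triples_def)
  define p q r where "p = vertex j k" and "q = vertex i k" and "r = vertex i j"
  have tri: "triangle S = interior (convex hull {p, q, r})"
    using vertices_eq[OF I ijk(2,3,4)] by (simp add: triangle_def ijk(1) p_def q_def r_def)
  have on: "{q, r} \<subseteq> line i" "{p, r} \<subseteq> line j" "{p, q} \<subseteq> line k"
    using I ijk by (simp_all add: p_def q_def r_def vertex_in_line)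
  then have h0: "height i q = 0" "height i r = 0" "height j p = 0" "height j r = 0"
     "height k p = 0" "height k q = 0" by (auto simp: line_def)
  have off: "p \<notin> line i" "q \<notin> line j" "r \<notin> line k"
    using vertex_not_in_line I ijk unfolding p_def q_def r_def by auto
  then have h1: "height i p \<noteq> 0" "height j q \<noteq> 0" "height k r \<noteq> 0" by (auto simp: line_def)
  have neq: "p \<noteq> q" "p \<noteq> r" "q \<noteq> r" using on off by auto
  have ind: "\<not> affine_dependent {p, q, r}"
  proof (rule affine_independent_insert[OF affine_independent_2])
    show "p \<notin> affine hull {q, r}"
      using hull_minimal[of "{q, r}" "line i" affine] on(1) off(1) affine_line by blast
  qed
  have noncol: "\<not> collinear {p, q, r}"
    using ind neq by (simp add: collinear_3_eq_affine_dependent)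
  have int: "interior (convex hull {p, q, r}) =
     {v. \<exists>x y z. 0 < x \<and> 0 < y \<and> 0 < z \<and> x + y + z = 1 \<and> x *\<^sub>R p + y *\<^sub>R q + z *\<^sub>R r = v}"
    using noncol by (intro interior_convex_hull_3_minimal) auto
  define c where "c = (1/3) *\<^sub>R p + (1/3) *\<^sub>R q + (1/3) *\<^sub>R r"
  have hc: "height l c = (height l p + height l q + height l r) / 3" for l
    unfolding c_def by (subst height_affine3) auto
  have same: "0 < height l p * height l q" "0 < height l p * height l r" "0 < height l q * height l r"
    if "l \<in> I - {i, j, k}" for l
    using S that unfolding ijk(1) empty_triple_iff[OF I ijk(2,3,4)] p_def q_def r_def
    by (auto simp: mult.commute)
  have hull_UNIV: "affine hull {p, q, r} = UNIV"
    using ind neq by (intro affine_independent_span_eq) auto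
  have cell: "cell c = interior (convex hull {p, q, r})"
  proof (intro set_eqI iffI)
    fix z assume z: "z \<in> cell c"
    obtain x y w where xyw: "x + y + w = 1" "z = x *\<^sub>R p + y *\<^sub>R q + w *\<^sub>R r"
      using hull_UNIV unfolding affine_hull_3 by blast
    have "0 < height i z * height i c" "0 < height j z * height j c" "0 < height k z * height k c"
      using z I by (auto simp: cell_def)
    \<comment> \<open>Each side line passes through two vertices, so only the term of the opposite
      vertex survives, both for \<open>z\<close> and for the centroid.\<close>
    then have "0 < x * height i p * (height i p / 3)" "0 < y * height j q * (height j q / 3)"
      "0 < w * height k r * (height k r / 3)"
      unfolding xyw(2) height_affine3[OF xyw(1)] hc by (simp_all add: h0)
    moreover have "0 < a" if "0 < a * b * (b / 3)" for a b :: real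
      using that by (auto simp: zero_less_mult_iff mult_less_0_iff)
    ultimately have "0 < x" "0 < y" "0 < w" by blast+
    then show "z \<in> interior (convex hull {p, q, r})" using xyw int by auto
  next
    fix z assume "z \<in> interior (convex hull {p, q, r})"
    then obtain x y w where xyw: "0 < x" "0 < y" "0 < w" "x + y + w = 1" "z = x *\<^sub>R p + y *\<^sub>R q + w *\<^sub>R r"
      using int by auto
    show "z \<in> cell c"
      unfolding cell_def
    proof safe
      fix l assume l: "l \<in> I"
      have hz: "height l z = x * height l p + y * height l q + w * height l r" for l
        unfolding xyw(5) by (rule height_affine3[OF xyw(4)])
      have pos: "0 < a * b * b" if "0 < a" "b \<noteq> 0" for a b :: real
        using that by (auto simp: zero_less_mult_iff mult_less_0_iff linorder_neq_iff)
      consider "l = i" | "l = j" | "l = k" | "l \<in> I - {i, j, k}" using l by blast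
      then show "0 < height l z * height l c"
      proof cases
        case 4
        have "0 < height l p \<and> 0 < height l q \<and> 0 < height l r \<or> height l p < 0 \<and> height l q < 0 \<and> height l r < 0"
          using same[OF 4] by (auto simp: zero_less_mult_iff)
        then show ?thesis
        proof
          assume a: "0 < height l p \<and> 0 < height l q \<and> 0 < height l r"
          then show ?thesis using xyw unfolding hz hc by (intro mult_pos_pos) (auto intro!: add_pos_pos)
        next
          assume a: "height l p < 0 \<and> height l q < 0 \<and> height l r < 0"
          then show ?thesis using xyw unfolding hz hc
            by (intro mult_neg_neg) (auto intro!: add_neg_neg mult_pos_neg)
        qed
      qed (use h0 h1 xyw(1-3) in \<open>simp_all add: hz hc pos\<close>)
    qed
  qed
  have c_in: "c \<in> interior (convex hull {p, q, r})"
    unfolding int c_def by (rule CollectI, intro exI[of _ "1/3"]) simp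
  then have "c \<notin> \<Union>(line ` I)" using cell_disjoint_lines cell by blast
  then have face: "triangle S \<in> faces (line ` I)"
    unfolding faces_eq_cells tri cell[symmetric] by blast
  have closure: "closure (triangle S) = convex hull {p, q, r}"
    using c_in convex_closure_interior[of "convex hull {p, q, r}"]
    unfolding tri by (auto simp: compact_imp_closed finite_imp_compact_convex_hull)
  have "bounded (triangle S)"
    unfolding tri by (rule bounded_subset[OF _ interior_subset]) (simp add: finite_imp_bounded_convex_hull)
  moreover have "2 simplex closure (triangle S)"
    unfolding closure using ind neq by (intro simplex_convex_hull) auto
  ultimately have "triangle S \<in> bounded_triangular_faces (line ` I)"
    using face by (simp add: bounded_triangular_faces_def)
  moreover have "touching (triangle S) = S"
    unfolding ijk(1) using ijk closure I ind neq on by (intro touching_triangle[of i j k p q r]) auto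
  ultimately show ?thesis by blast
qed

lemma bij_betw_touching:
  "bij_betw touching (bounded_triangular_faces (line ` I)) empty_triples"
  using bounded_triangular_face_imp empty_triple_imp
  by (intro bij_betw_byWitness[where f' = triangle]) auto

lemma card_bounded_triangular_faces:
  "card (bounded_triangular_faces (line ` I)) = card empty_triples"
  using bij_betw_touching by (rule bij_betw_same_card)

lemma card_touching_faces:
  assumes "i \<in> I"
  shows "card {F \<in> bounded_triangular_faces (line ` I). touches (line i) F} = card {S \<in> empty_triples. i \<in> S}"
proof -
  have img: "touching ` {F \<in> bounded_triangular_faces (line ` I). touches (line i) F} = {S \<in> empty_triples. i \<in> S}"
    using bij_betw_imp_surj_on[OF bij_betw_touching] assms by (auto simp: touching_def)
  have "inj_on touching {F \<in> bounded_triangular_faces (line ` I). touches (line i) F}"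
    using bij_betw_imp_inj_on[OF bij_betw_touching] by (rule inj_on_subset) auto
  from card_image[OF this] show ?thesis by (simp add: img)
qed

end

section \<open>Counting from the order of the crossings\<close>

definition adjacent_in :: "'a list \<Rightarrow> 'a \<Rightarrow> 'a \<Rightarrow> bool" where
  "adjacent_in xs x y \<longleftrightarrow> (x, y) \<in> set (zip xs (tl xs)) \<or> (y, x) \<in> set (zip xs (tl xs))"

lemma in_set_zip_tl_iff:
  "(x, y) \<in> set (zip xs (tl xs)) \<longleftrightarrow> (\<exists>n. Suc n < length xs \<and> x = xs ! n \<and> y = xs ! Suc n)"
proof
  assume "(x, y) \<in> set (zip xs (tl xs))"
  then obtain n where "n < length (tl xs)" "x = xs ! n" "y = tl xs ! n"
    by (auto simp: set_zip min_def split: if_splits)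
  then show "\<exists>n. Suc n < length xs \<and> x = xs ! n \<and> y = xs ! Suc n"
    by (intro exI[of _ n]) (auto simp: nth_tl)
next
  assume "\<exists>n. Suc n < length xs \<and> x = xs ! n \<and> y = xs ! Suc n"
  then obtain n where "Suc n < length xs" "x = xs ! n" "y = xs ! Suc n" by blast
  then show "(x, y) \<in> set (zip xs (tl xs))"
    by (auto simp: set_zip nth_tl intro!: exI[of _ n])
qed

text \<open>Used for the slopes: every line occurs in some tested pair of each row but its
  own.\<close>

lemma ex_zip_tl:
  assumes "x \<in> set xs" "2 \<le> length xs"
  shows "\<exists>y. (x, y) \<in> set (zip xs (tl xs)) \<or> (y, x) \<in> set (zip xs (tl xs))"
proof -
  obtain n where n: "n < length xs" "x = xs ! n" using assms(1) by (auto simp: in_set_conv_nth)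
  show ?thesis
  proof (cases n)
    case 0
    then have "(x, xs ! 1) \<in> set (zip xs (tl xs))"
      unfolding in_set_zip_tl_iff using n assms(2) by (intro exI[of _ 0]) auto
    then show ?thesis by blast
  next
    case (Suc k)
    then have "(xs ! k, x) \<in> set (zip xs (tl xs))"
      unfolding in_set_zip_tl_iff using n by (intro exI[of _ k]) auto
    then show ?thesis by blast
  qed
qed

text \<open>In a list with strictly increasing keys the order of keys is the order of positions, so
  nothing lies between two entries iff their positions differ by one.\<close>

lemma zip_tl_sorted_iff:
  fixes key :: "'a \<Rightarrow> 'b::linorder"
  assumes sorted: "sorted_wrt (\<lambda>x y. key x < key y) xs" and "x \<in> set xs" "y \<in> set xs"
  shows "(x, y) \<in> set (zip xs (tl xs)) \<longleftrightarrow>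
    key x < key y \<and> (\<forall>z\<in>set xs. \<not> (key x < key z \<and> key z < key y))"
proof -
  have less_iff: "key (xs ! m) < key (xs ! n) \<longleftrightarrow> m < n" if "m < length xs" "n < length xs" for m n
    using sorted_wrt_nth_less[OF sorted, of m n] sorted_wrt_nth_less[OF sorted, of n m] that
    by (cases m n rule: linorder_cases) auto
  show ?thesis
  proof
    assume "(x, y) \<in> set (zip xs (tl xs))"
    then obtain n where "Suc n < length xs" "x = xs ! n" "y = xs ! Suc n"
      by (auto simp: in_set_zip_tl_iff)
    then show "key x < key y \<and> (\<forall>z\<in>set xs. \<not> (key x < key z \<and> key z < key y))"
      by (auto simp: in_set_conv_nth less_iff)
  next
    assume r: "key x < key y \<and> (\<forall>z\<in>set xs. \<not> (key x < key z \<and> key z < key y))"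
    obtain m n where mn: "m < length xs" "x = xs ! m" "n < length xs" "y = xs ! n"
      using assms(2,3) by (auto simp: in_set_conv_nth)
    then have "m < n" using r less_iff by auto
    moreover have "\<not> Suc m < n"
    proof
      assume "Suc m < n"
      then have "xs ! Suc m \<in> set xs" "key x < key (xs ! Suc m)" "key (xs ! Suc m) < key y"
        using mn less_iff by auto
      then show False using r by blast
    qed
    ultimately have "n = Suc m" by simp
    then show "(x, y) \<in> set (zip xs (tl xs))" using mn by (auto simp: in_set_zip_tl_iff)
  qed
qed

lemma adjacent_in_sorted_iff:
  fixes key :: "'a \<Rightarrow> 'b::linorder"
  assumes "sorted_wrt (\<lambda>x y. key x < key y) xs" "x \<in> set xs" "y \<in> set xs" "key x \<noteq> key y"
  shows "adjacent_in xs x y \<longleftrightarrow>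
    (\<forall>z\<in>set xs. \<not> (key x < key z \<and> key z < key y) \<and> \<not> (key y < key z \<and> key z < key x))"
  unfolding adjacent_in_def zip_tl_sorted_iff[OF assms(1-3)] zip_tl_sorted_iff[OF assms(1,3,2)]
  using assms(4) by (auto simp: linorder_neq_iff)

locale sorted_line_family = line_family I s t
  for I :: "'i::linorder set" and s t :: "'i \<Rightarrow> real" +
  fixes along :: "'i \<Rightarrow> 'i list"
  assumes set_along: "i \<in> I \<Longrightarrow> set (along i) = I - {i}"
    and sorted_along: "i \<in> I \<Longrightarrow> sorted_wrt (\<lambda>j k. crossing i j < crossing i k) (along i)"
begin

text \<open>Strictly sorted rows already separate the crossings on each line, so triple points need
  no test of their own.\<close>

sublocale simple_line_family
proof
  fix i j k assume h: "i \<in> I" "j \<in> I" "k \<in> I" "i \<noteq> j" "i \<noteq> k" "j \<noteq> k"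
  then have "j \<in> set (along i)" "k \<in> set (along i)" by (auto simp: set_along)
  then obtain a b where "a < length (along i)" "j = along i ! a" "b < length (along i)" "k = along i ! b"
    by (auto simp: in_set_conv_nth)
  then show "crossing i j \<noteq> crossing i k"
    using sorted_wrt_nth_less[OF sorted_along[OF h(1)], of a b]
      sorted_wrt_nth_less[OF sorted_along[OF h(1)], of b a] h(6)
    by (cases a b rule: linorder_cases) auto
qed

text \<open>The empty triples with least element \<open>i\<close>, each listed once, as the pair of its other two lines
  in the order in which \<open>i\<close> meets them.\<close>

definition triangles_at :: "'i \<Rightarrow> ('i \<times> 'i) list" where
  "triangles_at i = filter (\<lambda>(j, k). i < j \<and> i < k \<and>
     adjacent_in (along j) i k \<and> adjacent_in (along k) i j) (zip (along i) (tl (along i)))"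

lemma adjacent_along_iff:
  assumes "i \<in> I" "j \<in> I" "k \<in> I" "i \<noteq> j" "i \<noteq> k" "j \<noteq> k"
  shows "adjacent_in (along i) j k \<longleftrightarrow> (\<forall>l\<in>I - {i, j, k}.
     \<not> (crossing i j < crossing i l \<and> crossing i l < crossing i k) \<and>
     \<not> (crossing i k < crossing i l \<and> crossing i l < crossing i j))"
proof -
  have "adjacent_in (along i) j k \<longleftrightarrow> (\<forall>l\<in>I - {i}.
     \<not> (crossing i j < crossing i l \<and> crossing i l < crossing i k) \<and>
     \<not> (crossing i k < crossing i l \<and> crossing i l < crossing i j))"
    using adjacent_in_sorted_iff[OF sorted_along[OF assms(1)], of j k] crossing_neq[OF assms] assms
    by (simp add: set_along)
  then show ?thesis by auto
qed

lemma empty_triple_iff_adjacent: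
  assumes "i \<in> I" "j \<in> I" "k \<in> I" "i \<noteq> j" "i \<noteq> k" "j \<noteq> k"
  shows "{i, j, k} \<in> empty_triples \<longleftrightarrow>
    adjacent_in (along i) j k \<and> adjacent_in (along j) i k \<and> adjacent_in (along k) i j"
proof -
  have "card {i, j, k} = 3" using assms by simp
  then have "{i, j, k} \<in> empty_triples \<longleftrightarrow> (\<forall>l\<in>I - {i, j, k}.
      \<forall>a\<in>{i, j, k}. \<forall>b\<in>{i, j, k} - {a}. \<forall>c\<in>{i, j, k} - {a}.
        \<not> (crossing a b < crossing a l \<and> crossing a l < crossing a c))"
    using assms unfolding empty_triples_def by blast
  also have "\<dots> \<longleftrightarrow> (\<forall>l\<in>I - {i, j, k}.
     (\<not> (crossing i j < crossing i l \<and> crossing i l < crossing i k) \<and>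
     \<not> (crossing i k < crossing i l \<and> crossing i l < crossing i j)) \<and>
     (\<not> (crossing j i < crossing j l \<and> crossing j l < crossing j k) \<and>
     \<not> (crossing j k < crossing j l \<and> crossing j l < crossing j i)) \<and>
     (\<not> (crossing k i < crossing k l \<and> crossing k l < crossing k j) \<and>
     \<not> (crossing k j < crossing k l \<and> crossing k l < crossing k i)))"
    using assms by (intro ball_cong refl) (auto simp: insert_Diff_if)
  also have "\<dots> \<longleftrightarrow> adjacent_in (along i) j k \<and> adjacent_in (along j) i k \<and> adjacent_in (along k) i j"
    using assms by (simp add: adjacent_along_iff ball_conj_distrib insert_commute)
  finally show ?thesis .
qed

lemma triangles_atD:
  assumes "i \<in> I" "(j, k) \<in> set (triangles_at i)"
  shows "j \<in> I" "k \<in> I" "i < j" "i < k" "j \<noteq> k" "crossing i j < crossing i k" "{i, j, k} \<in> empty_triples"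
proof -
  have z: "(j, k) \<in> set (zip (along i) (tl (along i)))" and ij: "i < j" "i < k"
    and adj: "adjacent_in (along j) i k" "adjacent_in (along k) i j"
    using assms(2) by (auto simp: triangles_at_def)
  have "j \<in> set (along i)" "k \<in> set (along i)" using z by (auto simp: in_set_zip_tl_iff)
  then show I: "j \<in> I" "k \<in> I" and less: "crossing i j < crossing i k"
    using z zip_tl_sorted_iff[OF sorted_along[OF assms(1)], of j k] set_along[OF assms(1)] by auto
  then show neq: "j \<noteq> k" by auto
  show "i < j" "i < k" by fact+
  show "{i, j, k} \<in> empty_triples"
    using empty_triple_iff_adjacent[of i j k] assms(1) I ij neq adj z by (auto simp: adjacent_in_def)
qed

text \<open>The triple determines \<open>i\<close> as its minimum, and the order of the crossings on
  line \<open>i\<close> decides between \<open>(j, k)\<close> and \<open>(k, j)\<close>.\<close>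

lemma bij_betw_triangles_at:
  "bij_betw (\<lambda>(i, j, k). {i, j, k}) (SIGMA i:I. set (triangles_at i)) empty_triples"
  unfolding bij_betw_def
proof
  show "inj_on (\<lambda>(i, j, k). {i, j, k}) (SIGMA i:I. set (triangles_at i))"
  proof (rule inj_onI, clarify)
    fix i j k i' j' k'
    assume i: "i \<in> I" "(j, k) \<in> set (triangles_at i)" and i': "i' \<in> I" "(j', k') \<in> set (triangles_at i')"
      and eq: "{i, j, k} = {i', j', k'}"
    note D = triangles_atD[OF i] and D' = triangles_atD[OF i']
    have "Min {i, j, k} = i" "Min {i', j', k'} = i'" using D D' by auto
    then have ii: "i = i'" using eq by simp
    then have "{j, k} = {j', k'}" using eq D D' by (metis insert_ident insertE less_irrefl singletonD)
    moreover have "\<not> (j = k' \<and> k = j')" using D(6) D'(6) ii by auto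
    ultimately show "i = i' \<and> (j, k) = (j', k')" using ii by (auto simp: doubleton_eq_iff)
  qed
  show "(\<lambda>(i, j, k). {i, j, k}) ` (SIGMA i:I. set (triangles_at i)) = empty_triples"
  proof
    show "(\<lambda>(i, j, k). {i, j, k}) ` (SIGMA i:I. set (triangles_at i)) \<subseteq> empty_triples"
      using triangles_atD(7) by auto
    show "empty_triples \<subseteq> (\<lambda>(i, j, k). {i, j, k}) ` (SIGMA i:I. set (triangles_at i))"
    proof
      fix S assume S: "S \<in> empty_triples"
      then have SI: "S \<subseteq> I" "card S = 3" by (auto simp: empty_triples_def)
      then have fin: "finite S" "S \<noteq> {}" by (auto intro: card_ge_0_finite)
      define i where "i = Min S"
      have iS: "i \<in> S" using fin by (simp add: i_def)
      have "card (S - {i}) = 2" using iS SI fin by simp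
      then obtain j k where jk: "S - {i} = {j, k}" "j \<noteq> k" by (auto simp: card_2_iff)
      have S_eq: "S = {i, j, k}" using jk iS by auto
      have ne: "i \<noteq> j" "i \<noteq> k" using jk by auto
      have "i \<le> j" "i \<le> k" unfolding i_def using Min_le[OF fin(1)] S_eq by blast+
      then have less: "i < j" "i < k" using ne by auto
      have I: "i \<in> I" "j \<in> I" "k \<in> I" using SI S_eq by auto
      have adj: "adjacent_in (along i) j k" "adjacent_in (along j) i k" "adjacent_in (along k) i j"
        using empty_triple_iff_adjacent[OF I ne jk(2)] S S_eq by auto
      then have "(j, k) \<in> set (triangles_at i) \<or> (k, j) \<in> set (triangles_at i)"
        using less by (auto simp: triangles_at_def adjacent_in_def)
      then show "S \<in> (\<lambda>(i, j, k). {i, j, k}) ` (SIGMA i:I. set (triangles_at i))"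
      proof
        assume "(j, k) \<in> set (triangles_at i)"
        then show ?thesis using I S_eq by (intro image_eqI[of _ _ "(i, j, k)"]) auto
      next
        assume "(k, j) \<in> set (triangles_at i)"
        then show ?thesis using I S_eq by (intro image_eqI[of _ _ "(i, k, j)"]) auto
      qed
    qed
  qed
qed

lemma card_set_triangles_at:
  assumes "i \<in> I"
  shows "card (set (triangles_at i)) = length (triangles_at i)"
proof (rule distinct_card)
  have "distinct (along i)"
    using sorted_along[OF assms] unfolding sorted_wrt_iff_nth_less distinct_conv_nth
    by (metis less_irrefl linorder_neqE_nat)
  then show "distinct (triangles_at i)" by (simp add: triangles_at_def distinct_zipI1)
qed

lemma card_empty_triples: "card empty_triples = (\<Sum>i\<in>I. length (triangles_at i))"
  using bij_betw_same_card[OF bij_betw_triangles_at]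
  by (simp add: card_SigmaI finite_I card_set_triangles_at)

text \<open>A triple containing the least index of all has it as its own minimum, so all such
  triples are listed at \<open>i\<close>.\<close>

lemma card_empty_triples_least:
  assumes "i \<in> I" "\<And>j. j \<in> I \<Longrightarrow> i \<le> j"
  shows "card {S \<in> empty_triples. i \<in> S} = length (triangles_at i)"
proof -
  let ?f = "\<lambda>(i, j, k). {i, j, k}"
  have eq: "{S \<in> empty_triples. i \<in> S} = ?f ` ({i} \<times> set (triangles_at i))"
  proof
    show "{S \<in> empty_triples. i \<in> S} \<subseteq> ?f ` ({i} \<times> set (triangles_at i))"
    proof
      fix S assume S: "S \<in> {S \<in> empty_triples. i \<in> S}"
      then have "S \<in> ?f ` (SIGMA i:I. set (triangles_at i))"
        using bij_betw_imp_surj_on[OF bij_betw_triangles_at] by simp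
      then obtain h j k where h: "h \<in> I" "(j, k) \<in> set (triangles_at h)" "S = {h, j, k}" by auto
      have "h < j" "h < k" "i \<le> h" using triangles_atD(3,4)[OF h(1,2)] assms(2) h(1) by auto
      moreover have "i \<in> {h, j, k}" using S h(3) by simp
      ultimately have "i = h" by auto
      then show "S \<in> ?f ` ({i} \<times> set (triangles_at i))"
        using h by (intro image_eqI[of _ _ "(h, j, k)"]) auto
    qed
    show "?f ` ({i} \<times> set (triangles_at i)) \<subseteq> {S \<in> empty_triples. i \<in> S}"
      using triangles_atD(7)[OF assms(1)] by auto
  qed
  have "inj_on ?f ({i} \<times> set (triangles_at i))"
    using bij_betw_imp_inj_on[OF bij_betw_triangles_at] by (rule inj_on_subset) (use assms in auto)
  from card_image[OF this] show ?thesis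
    unfolding eq using assms by (simp add: card_set_triangles_at)
qed

end

section \<open>Interval arithmetic\<close>

definition encloses :: "int \<times> int \<Rightarrow> real \<Rightarrow> bool" where
  "encloses p x \<longleftrightarrow> of_int (fst p) \<le> x \<and> x \<le> of_int (snd p)"

text \<open>Equations on explicit pairs make \<open>code_simp\<close> evaluate the arguments before they are duplicated.\<close>

fun interval_add :: "int \<times> int \<Rightarrow> int \<times> int \<Rightarrow> int \<times> int" where
  "interval_add (a, b) (c, d) = (a + c, b + d)"

fun interval_diff :: "int \<times> int \<Rightarrow> int \<times> int \<Rightarrow> int \<times> int" where
  "interval_diff (a, b) (c, d) = (a - d, b - c)"

fun interval_mult :: "int \<times> int \<Rightarrow> int \<times> int \<Rightarrow> int \<times> int" where
  "interval_mult (a, b) (c, d) =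
     (min (min (a * c) (a * d)) (min (b * c) (b * d)),
      max (max (a * c) (a * d)) (max (b * c) (b * d)))"

lemma encloses_add: "encloses p x \<Longrightarrow> encloses q y \<Longrightarrow> encloses (interval_add p q) (x + y)"
  by (cases p; cases q) (simp add: encloses_def)

lemma encloses_diff: "encloses p x \<Longrightarrow> encloses q y \<Longrightarrow> encloses (interval_diff p q) (x - y)"
  by (cases p; cases q) (simp add: encloses_def)

lemma mult_between_endpoints:
  fixes a b x y :: real
  assumes "a \<le> x" "x \<le> b"
  shows "min (a * y) (b * y) \<le> x * y" "x * y \<le> max (a * y) (b * y)"
  using mult_right_mono[of a x y] mult_right_mono[of x b y]
    mult_right_mono_neg[of a x y] mult_right_mono_neg[of x b y] assms
  by (cases "0 \<le> y"; fastforce)+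

lemma encloses_mult:
  assumes "encloses p x" "encloses q y"
  shows "encloses (interval_mult p q) (x * y)"
proof -
  obtain a b where p: "p = (a, b)" by (cases p)
  obtain c d where q: "q = (c, d)" by (cases q)
  have x: "of_int a \<le> x" "x \<le> of_int b" and y: "of_int c \<le> y" "y \<le> of_int d"
    using assms by (auto simp: encloses_def p q)
  show ?thesis
    unfolding encloses_def interval_mult.simps p q fst_conv snd_conv of_int_min of_int_max of_int_mult
    \<comment> \<open>The product is linear in each factor: first \<open>x\<close> moves to an
      endpoint, then \<open>y\<close> does for each of the two endpoints of
      \<open>x\<close>.\<close>
    using mult_between_endpoints[OF x, of y]
      mult_between_endpoints[OF y, of "of_int a"] mult_between_endpoints[OF y, of "of_int b"]
    by (simp add: mult.commute) linarith
qed

text \<open>The numerator of \<open>x\<^sub>k - x\<^sub>j\<close>, where \<open>x\<^sub>j\<close> is the abscissa at which the line \<open>y = m\<^sub>i (x - a\<^sub>i)\<close> meets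
  \<open>y = m\<^sub>j (x - a\<^sub>j)\<close>, multiplied by its denominator: the sign is that of \<open>x\<^sub>k - x\<^sub>j\<close>.\<close>

definition crossing_gap :: "(nat \<Rightarrow> real) \<Rightarrow> (nat \<Rightarrow> real) \<Rightarrow> nat \<Rightarrow> nat \<Rightarrow> nat \<Rightarrow> real" where
  "crossing_gap m a i j k = (m i - m j) * (m i - m k) *
     (m j * m k * (a k - a j) + (m i * m k * (a i - a k) + m i * m j * (a j - a i)))"

fun gap_interval ::
    "(int \<times> int) \<times> int \<times> int \<Rightarrow> (int \<times> int) \<times> int \<times> int \<Rightarrow> (int \<times> int) \<times> int \<times> int \<Rightarrow> int \<times> int" where
  "gap_interval (mi, ai) (mj, aj) (mk, ak) =
    interval_mult (interval_mult (interval_diff mi mj) (interval_diff mi mk))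
      (interval_add (interval_mult (interval_mult mj mk) (interval_diff ak aj))
        (interval_add (interval_mult (interval_mult mi mk) (interval_diff ai ak))
          (interval_mult (interval_mult mi mj) (interval_diff aj ai))))"

lemma encloses_gap_interval:
  assumes "\<And>l. l \<in> {i, j, k} \<Longrightarrow> encloses (fst (B l)) (m l) \<and> encloses (snd (B l)) (a l)"
  shows "encloses (gap_interval (B i) (B j) (B k)) (crossing_gap m a i j k)"
proof -
  have "encloses (gap_interval (fst (B i), snd (B i)) (fst (B j), snd (B j)) (fst (B k), snd (B k)))
      (crossing_gap m a i j k)"
    unfolding gap_interval.simps crossing_gap_def
    using assms by (intro encloses_mult encloses_add encloses_diff) auto
  then show ?thesis by simp
qed

text \<open>The gap is homogeneous of degree 4 in the slopes and 1 in the intercepts, so passing to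
  integer units preserves its sign.\<close>

lemma crossing_gap_scale:
  "crossing_gap (\<lambda>i. c * m i) (\<lambda>i. d * a i) i j k = c ^ 4 * d * crossing_gap m a i j k"
proof -
  have 1: "c * m x * (c * m y) * (d * a z - d * a w) = c\<^sup>2 * d * (m x * m y * (a z - a w))" for x y z w
    by (simp add: power2_eq_square right_diff_distrib mult_ac)
  have 2: "(c * m i - c * m j) * (c * m i - c * m k) = c\<^sup>2 * ((m i - m j) * (m i - m k))"
    by (simp add: power2_eq_square right_diff_distrib[symmetric] mult_ac)
  show ?thesis
    unfolding crossing_gap_def 1 2
    by (simp add: power4_eq_xxxx power2_eq_square distrib_left[symmetric] mult_ac)
qed

lemma crossing_less_if_gap_pos:
  assumes "0 < crossing_gap m a i j k"
  shows "(- m j * a j - - m i * a i) / (m i - m j) < (- m k * a k - - m i * a i) / (m i - m k)"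
proof -
  have ne: "m i - m j \<noteq> 0" "m i - m k \<noteq> 0" using assms by (auto simp: crossing_gap_def)
  have "(- m k * a k - - m i * a i) / (m i - m k) - (- m j * a j - - m i * a i) / (m i - m j)
    = crossing_gap m a i j k / ((m i - m j) * (m i - m k))\<^sup>2"
    using ne unfolding crossing_gap_def
    by (simp add: divide_simps power2_eq_square) (simp add: algebra_simps)
  moreover have "0 < crossing_gap m a i j k / ((m i - m j) * (m i - m k))\<^sup>2"
    using assms ne by simp
  ultimately show ?thesis by linarith
qed

section \<open>Bounds for the tangents\<close>

text \<open>The difference of the two sides factors as
  \<open>(a - t) * (3 - (a * a + a * t + t * t))\<close>.\<close>

lemma cubic_mono:
  fixes t a :: real
  assumes "0 \<le> t" "t \<le> a" "a \<le> 1"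
  shows "3 * t - t ^ 3 \<le> 3 * a - a ^ 3"
proof -
  have "a * a \<le> 1" "a * t \<le> 1" "t * t \<le> 1" using assms by (auto intro!: mult_le_one)
  then have "0 \<le> (a - t) * (3 - (a * a + a * t + t * t))" using assms by (intro mult_nonneg_nonneg) auto
  then show ?thesis by (simp add: algebra_simps power3_eq_cube)
qed

lemma sqrt_3_bounds: "1.73205 < sqrt 3" "sqrt 3 < 1.73206"
proof -
  show "1.73205 < sqrt 3" by (rule real_less_rsqrt) (simp add: power2_eq_square)
  show "sqrt 3 < 1.73206" by (rule real_less_lsqrt) (simp_all add: power2_eq_square)
qed

text \<open>In the equation for the tangent of the tripled angle, \<open>3 * t - t ^ 3\<close>
  increases and \<open>(1 - 3 * t\<^sup>2) / sqrt 3\<close> decreases, so a value beyond either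
  endpoint is refuted by evaluation there. Five decimals are kept because the reciprocal, needed for
  \<open>8 * pi / 18\<close>, magnifies the error about 32 times.\<close>

lemma tan_pi_18_bounds: "tan (pi / 18) \<in> {17632 / 10 ^ 5 .. 17633 / 10 ^ 5}"
proof -
  define t where "t = tan (pi / 18)"
  have t_pos: "0 < t" unfolding t_def by (rule tan_gt_zero) auto
  have cos_pos: "cos (pi / 18) > 0" "cos (2 * (pi / 18)) > 0" "cos (pi / 18 + 2 * (pi / 18)) > 0"
    using pi_gt_zero by (intro cos_gt_zero; linarith)+
  have "t < tan (pi / 4)" unfolding t_def by (intro tan_monotone) auto
  then have t1: "t < 1" by (simp add: tan_45)
  then have sq: "t\<^sup>2 < 1" using t_pos by (simp add: power_less_one_iff)
  have t2: "tan (2 * (pi / 18)) = 2 * t / (1 - t\<^sup>2)"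
    unfolding t_def using cos_pos by (intro tan_double) auto
  \<comment> \<open>The triple-angle formula makes \<open>t\<close> a root of a cubic equation.\<close>
  have "1 / sqrt 3 = tan (pi / 18 + 2 * (pi / 18))" by (simp add: tan_30[symmetric])
  also have "\<dots> = (t + 2 * t / (1 - t\<^sup>2)) / (1 - t * (2 * t / (1 - t\<^sup>2)))"
    using cos_pos tan_add[of "pi / 18" "2 * (pi / 18)"] unfolding t2 by (simp add: t_def)
  also have "\<dots> = (3 * t - t ^ 3) / (1 - 3 * t\<^sup>2)"
  proof -
    have "t + 2 * t / (1 - t\<^sup>2) = (3 * t - t ^ 3) / (1 - t\<^sup>2)"
      using sq by (simp add: field_simps power2_eq_square power3_eq_cube)
    moreover have "1 - t * (2 * t / (1 - t\<^sup>2)) = (1 - 3 * t\<^sup>2) / (1 - t\<^sup>2)"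
      using sq by (simp add: field_simps power2_eq_square)
    ultimately show ?thesis using sq by simp
  qed
  finally have eq: "1 / sqrt 3 = (3 * t - t ^ 3) / (1 - 3 * t\<^sup>2)" .
  \<comment> \<open>Division by zero yields 0, which \<open>1 / sqrt 3\<close> is not.\<close>
  then have "1 - 3 * t\<^sup>2 \<noteq> 0"
    by (metis div_by_0 divide_eq_0_iff real_sqrt_eq_zero_cancel_iff zero_neq_numeral zero_neq_one)
  then have root: "3 * t - t ^ 3 = (1 - 3 * t\<^sup>2) / sqrt 3" using eq by (simp add: field_simps)
  note s3 = sqrt_3_bounds
  have "17632 / 10 ^ 5 \<le> t"
  proof (rule ccontr)
    assume "\<not> ?thesis"
    then have lt: "t \<le> 17632 / 10 ^ 5" by simp
    have "t\<^sup>2 \<le> (17632 / 10 ^ 5)\<^sup>2" using lt t_pos by (intro power_mono) auto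
    then have "(1 - 3 * (17632 / 10 ^ 5)\<^sup>2) / sqrt 3 \<le> (1 - 3 * t\<^sup>2) / sqrt 3"
      by (intro divide_right_mono) auto
    also have "\<dots> \<le> 3 * (17632 / 10 ^ 5) - (17632 / 10 ^ 5) ^ 3"
      unfolding root[symmetric] using lt t_pos by (intro cubic_mono) auto
    finally have "1 - 3 * (17632 / 10 ^ 5)\<^sup>2 \<le> (3 * (17632 / 10 ^ 5) - (17632 / 10 ^ 5) ^ 3) * sqrt 3"
      by (simp add: divide_le_eq)
    also have "\<dots> \<le> (3 * (17632 / 10 ^ 5) - (17632 / 10 ^ 5) ^ 3) * 1.73206"
      using s3 by (intro mult_left_mono) (auto simp: power3_eq_cube)
    finally show False by (simp add: power2_eq_square power3_eq_cube)
  qed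
  moreover have "t \<le> 17633 / 10 ^ 5"
  proof (rule ccontr)
    assume "\<not> ?thesis"
    then have gt: "17633 / 10 ^ 5 \<le> t" by simp
    have "(17633 / 10 ^ 5)\<^sup>2 \<le> t\<^sup>2" using gt by (intro power_mono) auto
    then have "(1 - 3 * t\<^sup>2) / sqrt 3 \<le> (1 - 3 * (17633 / 10 ^ 5)\<^sup>2) / sqrt 3"
      by (intro divide_right_mono) auto
    moreover have "3 * (17633 / 10 ^ 5) - (17633 / 10 ^ 5) ^ 3 \<le> (1 - 3 * t\<^sup>2) / sqrt 3"
      unfolding root[symmetric] using gt t1 by (intro cubic_mono) auto
    ultimately have "(3 * (17633 / 10 ^ 5) - (17633 / 10 ^ 5) ^ 3) * sqrt 3 \<le> 1 - 3 * (17633 / 10 ^ 5 :: real)\<^sup>2"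
      by (simp add: le_divide_eq)
    moreover have "(3 * (17633 / 10 ^ 5) - (17633 / 10 ^ 5) ^ 3) * 1.73205 \<le> (3 * (17633 / 10 ^ 5) - (17633 / 10 ^ 5) ^ 3) * sqrt 3"
      using s3 by (intro mult_left_mono) (auto simp: power3_eq_cube)
    ultimately show False by (simp add: power2_eq_square power3_eq_cube)
  qed
  ultimately show ?thesis by (simp add: t_def)
qed

lemma double_tangent_bounds:
  fixes t :: real
  assumes "l \<le> t" "t \<le> u" "0 \<le> l" "u < 1"
  shows "2 * l / (1 - l\<^sup>2) \<le> 2 * t / (1 - t\<^sup>2)" "2 * t / (1 - t\<^sup>2) \<le> 2 * u / (1 - u\<^sup>2)"
proof -
  have "l\<^sup>2 \<le> t\<^sup>2" "t\<^sup>2 \<le> u\<^sup>2" "u\<^sup>2 < 1" using assms by (auto intro!: power_mono simp: power_less_one_iff)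
  moreover from this have "t\<^sup>2 < 1" by linarith
  ultimately show "2 * l / (1 - l\<^sup>2) \<le> 2 * t / (1 - t\<^sup>2)" "2 * t / (1 - t\<^sup>2) \<le> 2 * u / (1 - u\<^sup>2)"
    using assms by (auto intro!: frac_le)
qed

lemma tan_bounds:
  shows "tan (pi / 18) \<in> {0.176 .. 0.177}" "tan (2 * pi / 18) \<in> {0.363 .. 0.364}"
    "tan (3 * pi / 18) \<in> {0.577 .. 0.578}" "tan (4 * pi / 18) \<in> {0.839 .. 0.840}"
    "tan (5 * pi / 18) \<in> {1.191 .. 1.192}" "tan (6 * pi / 18) \<in> {1.732 .. 1.733}"
    "tan (7 * pi / 18) \<in> {2.747 .. 2.748}" "tan (8 * pi / 18) \<in> {5.671 .. 5.672}"
proof -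
  have t1: "17632 / 10 ^ 5 \<le> tan (pi / 18)" "tan (pi / 18) \<le> 17633 / 10 ^ 5"
    using tan_pi_18_bounds by auto
  have cos_pos: "cos (pi / 18) > 0" "cos (2 * (pi / 18)) > 0" "cos (2 * (2 * pi / 18)) > 0"
    using pi_gt_zero by (intro cos_gt_zero; linarith)+
  have "tan (2 * (pi / 18)) = 2 * tan (pi / 18) / (1 - (tan (pi / 18))\<^sup>2)"
    using cos_pos by (intro tan_double) auto
  then have t2: "0.36395 \<le> tan (2 * pi / 18)" "tan (2 * pi / 18) \<le> 0.36398"
    using double_tangent_bounds[OF t1] by (auto simp: power2_eq_square)
  have "tan (2 * (2 * pi / 18)) = 2 * tan (2 * pi / 18) / (1 - (tan (2 * pi / 18))\<^sup>2)"
    using cos_pos by (intro tan_double) auto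
  then have t4: "0.839 \<le> tan (4 * pi / 18)" "tan (4 * pi / 18) \<le> 0.8392"
    using double_tangent_bounds[OF t2] by (auto simp: power2_eq_square)
  \<comment> \<open>Complementary angles, as \<open>9 * pi / 18\<close> is a right angle. Doubling
    provides the multiples 2 and 4; the multiples 3 and 6 are exact in terms of
    \<open>sqrt 3\<close>.\<close>
  have comp: "tan (5 * pi / 18) = inverse (tan (4 * pi / 18))"
    "tan (7 * pi / 18) = inverse (tan (2 * pi / 18))" "tan (8 * pi / 18) = inverse (tan (pi / 18))"
    by (rule trans[OF _ tan_cot], rule arg_cong[of _ _ tan], linarith)+
  have inv: "inverse u \<le> inverse x \<and> inverse x \<le> inverse l" if "0 < l" "l \<le> x" "x \<le> u" for l x u :: real
    using that by (auto intro!: le_imp_inverse_le)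
  note s3 = sqrt_3_bounds
  show "tan (pi / 18) \<in> {0.176 .. 0.177}" "tan (2 * pi / 18) \<in> {0.363 .. 0.364}"
    "tan (4 * pi / 18) \<in> {0.839 .. 0.840}" using t1 t2 t4 by auto
  show "tan (5 * pi / 18) \<in> {1.191 .. 1.192}" "tan (7 * pi / 18) \<in> {2.747 .. 2.748}"
    "tan (8 * pi / 18) \<in> {5.671 .. 5.672}"
    unfolding comp using inv[OF _ t4] inv[OF _ t2] inv[OF _ t1] by auto
  have "tan (6 * pi / 18) = sqrt 3" using tan_60 by simp
  then show "tan (6 * pi / 18) \<in> {1.732 .. 1.733}" using s3 by auto
  have "tan (3 * pi / 18) = 1 / sqrt 3" using tan_30 by simp
  also have "\<dots> = sqrt 3 / 3" by (simp add: field_simps)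
  finally show "tan (3 * pi / 18) \<in> {0.577 .. 0.578}" using s3 by auto
qed

section \<open>The arrangement of 19 lines\<close>

text \<open>Entry \<open>i\<close> encloses the slope of line \<open>i\<close> in units of \<open>10\<^sup>-\<^sup>5\<close> and its intercept in units of
  \<open>10\<^sup>-\<^sup>3\<close>; entry \<open>0\<close> is \<open>Y\<^sub>0\<close>, regarded as \<open>y = 0 (x - 0)\<close>.\<close>

definition parameter_box :: "((int \<times> int) \<times> int \<times> int) list" where
  "parameter_box =
    [((0, 0), 0, 0), ((- 18016, - 17996), - 5672, - 5671),
     ((- 25241, - 25221), - 840, - 839), ((- 32594, - 32574), - 1733, - 1732),
     ((- 174531, - 174511), 2747, 2748), ((- 217951, - 217931), 176, 177),
     ((- 279567, - 279547), 1191, 1192), ((- 459596, - 459576), - 1192, - 1191),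
     ((- 567213, - 567193), - 1, 0), ((- 739915, - 739895), - 364, - 363),
     ((- 2307902, - 2307882), 577, 578), ((438995, 439015), - 2748, - 2747),
     ((290194, 290214), - 578, - 577), ((131835, 131855), 363, 364),
     ((90182, 90202), 839, 840), ((84491, 84511), 0, 1),
     ((64058, 64078), 1732, 1733), ((44383, 44403), - 177, - 176),
     ((15538, 15558), 5671, 5672)]"

text \<open>Row \<open>i\<close> lists the other lines in the order in which line \<open>i\<close> meets them from left to right;
  it was found numerically.\<close>

definition crossing_order :: "nat list list" where
  "crossing_order =
    [[1, 11, 3, 7, 2, 12, 9, 17, 8, 15, 5, 13, 10, 14, 6, 16, 4, 18],
     [0, 11, 17, 7, 15, 12, 18, 13, 14, 9, 16, 8, 10, 5, 6, 3, 4, 2],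
     [3, 11, 7, 0, 12, 17, 9, 15, 8, 13, 5, 14, 10, 16, 6, 18, 4, 1],
     [2, 11, 0, 7, 17, 12, 15, 9, 13, 8, 14, 5, 16, 10, 18, 6, 1, 4],
     [5, 7, 6, 9, 8, 11, 10, 12, 13, 15, 14, 17, 16, 0, 18, 2, 1, 3],
     [4, 7, 11, 9, 12, 8, 17, 15, 0, 13, 2, 14, 3, 16, 18, 10, 1, 6],
     [7, 4, 9, 11, 8, 12, 10, 15, 13, 17, 14, 0, 16, 2, 18, 3, 1, 5],
     [6, 4, 5, 11, 2, 0, 3, 17, 1, 15, 18, 12, 14, 13, 16, 9, 10, 8],
     [9, 4, 11, 6, 12, 5, 17, 0, 15, 2, 13, 3, 14, 18, 16, 1, 10, 7],
     [8, 4, 6, 11, 5, 12, 0, 17, 2, 15, 3, 13, 18, 14, 1, 16, 7, 10],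
     [11, 4, 12, 6, 15, 17, 13, 0, 14, 2, 16, 3, 18, 5, 1, 8, 7, 9],
     [12, 13, 14, 16, 15, 18, 17, 1, 0, 3, 2, 7, 5, 9, 6, 8, 4, 10],
     [11, 13, 16, 14, 7, 18, 1, 15, 3, 17, 2, 0, 9, 5, 8, 6, 10, 4],
     [11, 12, 16, 7, 14, 1, 18, 9, 3, 8, 2, 5, 0, 10, 17, 6, 15, 4],
     [11, 16, 12, 7, 13, 1, 9, 18, 8, 3, 5, 2, 10, 0, 6, 17, 4, 15],
     [16, 11, 18, 7, 1, 12, 3, 9, 2, 8, 0, 5, 17, 10, 6, 13, 4, 14],
     [15, 11, 14, 12, 13, 7, 9, 1, 8, 18, 5, 3, 10, 2, 6, 0, 4, 17],
     [18, 11, 1, 7, 3, 12, 2, 9, 0, 8, 5, 15, 10, 13, 6, 14, 4, 16],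
     [17, 11, 15, 7, 12, 1, 13, 9, 14, 8, 16, 5, 10, 3, 6, 2, 4, 0]]"

definition order_certified :: "nat \<Rightarrow> bool" where
  "order_certified i \<longleftrightarrow> (let xs = crossing_order ! i in
     list_all (\<lambda>(j, k). (i, j, k) \<in> {(0, 8, 15), (8, 0, 15), (15, 8, 0)} \<or>
       0 < fst (gap_interval (parameter_box ! i) (parameter_box ! j) (parameter_box ! k))) (zip xs (tl xs)))"

lemma order_certified_all: "list_all order_certified [0..<19]"
  by code_simp

lemma set_crossing_order: "i < 19 \<Longrightarrow> set (crossing_order ! i) = {..<19} - {i}"
proof -
  have "list_all (\<lambda>i. set (crossing_order ! i) = set [0..<19] - {i}) [0..<19]" by code_simp
  then show "i < 19 \<Longrightarrow> set (crossing_order ! i) = {..<19} - {i}"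
    by (simp add: list_all_iff atLeast0LessThan)
qed

text \<open>The length of \<open>triangles_at\<close> with the concrete rows, stated free of real
  parameters so that it can be evaluated.\<close>

definition triangle_count :: "nat \<Rightarrow> nat" where
  "triangle_count i = length (filter (\<lambda>(j, k). i < j \<and> i < k \<and>
     adjacent_in (crossing_order ! j) i k \<and> adjacent_in (crossing_order ! k) i j)
     (zip (crossing_order ! i) (tl (crossing_order ! i))))"

lemma triangle_counts: "triangle_count 0 = 17" "sum_list (map triangle_count [0..<19]) = 107"
  by code_simp+

text \<open>Index 0 needs its own case here and for the intercepts: \<open>m 0\<close> is arbitrary,
  and truncated subtraction would make \<open>intercept \<epsilon> 0\<close> equal to
  \<open>intercept \<epsilon> 1\<close>.\<close>

definition line_slope :: "(nat \<Rightarrow> real) \<Rightarrow> nat \<Rightarrow> real" where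
  "line_slope m i = (if i = 0 then 0 else m i)"

definition line_intercept :: "real \<Rightarrow> nat \<Rightarrow> real" where
  "line_intercept \<epsilon> i = (if i = 0 then 0 else intercept \<epsilon> i)"

definition line_offset :: "real \<Rightarrow> (nat \<Rightarrow> real) \<Rightarrow> nat \<Rightarrow> real" where
  "line_offset \<epsilon> m i = - line_slope m i * line_intercept \<epsilon> i"

lemma parameter_box_encloses:
  assumes eps: "\<epsilon> \<in> {0 <..< 1 / 10 ^ 4}"
    and m: "\<forall>i\<in>{1..18}. m i \<in> {slope_center i - 1 / 10 ^ 4 .. slope_center i + 1 / 10 ^ 4}"
    and i: "i < 19"
  shows "encloses (fst (parameter_box ! i)) (10 ^ 5 * line_slope m i)"
    and "encloses (snd (parameter_box ! i)) (10 ^ 3 * line_intercept \<epsilon> i)"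
proof -
  have cases: "i \<in> set [0..<19]" using i by simp
  show "encloses (fst (parameter_box ! i)) (10 ^ 5 * line_slope m i)"
  proof (cases "i = 0")
    case False
    then have "slope_center i - 1 / 10 ^ 4 \<le> m i \<and> m i \<le> slope_center i + 1 / 10 ^ 4"
      using m i by auto
    then show ?thesis
      using cases False
      by (auto simp: upt_rec encloses_def parameter_box_def line_slope_def slope_center_def)
  qed (simp add: encloses_def parameter_box_def line_slope_def)
  show "encloses (snd (parameter_box ! i)) (10 ^ 3 * line_intercept \<epsilon> i)"
    using cases eps tan_bounds
    by (auto simp: upt_rec encloses_def parameter_box_def line_intercept_def intercept_def)
qed

lemma crossing_gap_pos:
  assumes eps: "\<epsilon> \<in> {0 <..< 1 / 10 ^ 4}"
    and m: "\<forall>i\<in>{1..18}. m i \<in> {slope_center i - 1 / 10 ^ 4 .. slope_center i + 1 / 10 ^ 4}"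
    and i: "i < 19" and jk: "(j, k) \<in> set (zip (crossing_order ! i) (tl (crossing_order ! i)))"
  shows "0 < crossing_gap (line_slope m) (line_intercept \<epsilon>) i j k"
proof -
  have "j \<in> set (crossing_order ! i)" "k \<in> set (crossing_order ! i)"
    using jk by (auto simp: in_set_zip_tl_iff)
  then have jk19: "j < 19" "k < 19" by (auto simp: set_crossing_order[OF i])
  have "order_certified i" using order_certified_all i by (simp add: list_all_iff)
  then consider "(i, j, k) \<in> {(0, 8, 15), (8, 0, 15), (15, 8, 0)}"
    | "0 < fst (gap_interval (parameter_box ! i) (parameter_box ! j) (parameter_box ! k))"
    using jk unfolding order_certified_def Let_def list_all_iff by fast
  then show ?thesis
  proof cases
    case 1
    have "m 8 \<in> {slope_center 8 - 1 / 10 ^ 4 .. slope_center 8 + 1 / 10 ^ 4}"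
      "m 15 \<in> {slope_center 15 - 1 / 10 ^ 4 .. slope_center 15 + 1 / 10 ^ 4}" using m by auto
    then have neg: "m 8 < 0" and pos: "0 < m 15" by (auto simp: slope_center_def)
    have a: "line_intercept \<epsilon> 0 = 0" "line_intercept \<epsilon> 8 = - \<epsilon>" "line_intercept \<epsilon> 15 = \<epsilon>"
      "line_slope m 0 = 0" "line_slope m 8 = m 8" "line_slope m 15 = m 15" "0 < \<epsilon>"
      using eps by (simp_all add: line_intercept_def line_slope_def intercept_def)
    have "0 < (m 8)\<^sup>2" "0 < (m 15)\<^sup>2" "0 < m 15 - m 8" using neg pos by auto
    \<comment> \<open>The gaps of the three exempted triples, simplified with slope and intercept 0
      for \<open>Y0\<close>. Each keeps the factor \<open>2 * \<epsilon>\<close>, the distance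
      between the two intercepts.\<close>
    then have "0 < (m 8)\<^sup>2 * (m 15)\<^sup>2 * (2 * \<epsilon>)" "0 < (m 8)\<^sup>2 * (m 15 - m 8) * m 15 * (2 * \<epsilon>)"
      "0 < (m 15)\<^sup>2 * (m 15 - m 8) * (- m 8) * (2 * \<epsilon>)"
      using neg pos a(7) by (intro mult_pos_pos; simp)+
    then show ?thesis
      using 1 by (auto simp: crossing_gap_def a power2_eq_square algebra_simps)
  next
    case 2
    have "encloses (gap_interval (parameter_box ! i) (parameter_box ! j) (parameter_box ! k))
       (crossing_gap (\<lambda>i. 10 ^ 5 * line_slope m i) (\<lambda>i. 10 ^ 3 * line_intercept \<epsilon> i) i j k)"
      using parameter_box_encloses[OF eps m] i jk19 by (intro encloses_gap_interval) auto
    then have "0 < crossing_gap (\<lambda>i. 10 ^ 5 * line_slope m i) (\<lambda>i. 10 ^ 3 * line_intercept \<epsilon> i) i j k"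
      using 2 unfolding encloses_def by (meson less_le_trans of_int_0_less_iff)
    then show ?thesis unfolding crossing_gap_scale by (simp add: zero_less_mult_iff)
  qed
qed

lemma sorted_line_family_lines:
  assumes eps: "\<epsilon> \<in> {0 <..< 1 / 10 ^ 4}"
    and m: "\<forall>i\<in>{1..18}. m i \<in> {slope_center i - 1 / 10 ^ 4 .. slope_center i + 1 / 10 ^ 4}"
  shows "sorted_line_family {..<19} (line_slope m) (line_offset \<epsilon> m)
    ((!) crossing_order)"
proof -
  note gap = crossing_gap_pos[OF eps m]
  \<comment> \<open>Every gap of row \<open>i\<close> that involves \<open>j\<close> has the factor
    \<open>m i - m j\<close>; as \<open>j\<close> occurs in a tested pair of that row, equal slopes
    would contradict positivity.\<close>
  have inj: "inj_on (line_slope m) {..<19}"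
  proof (rule inj_onI, rule ccontr)
    fix i j assume ij: "i \<in> {..<19::nat}" "j \<in> {..<19}" "line_slope m i = line_slope m j" "i \<noteq> j"
    let ?xs = "crossing_order ! i"
    have set: "set ?xs = {..<19} - {i}" using ij by (simp add: set_crossing_order)
    then have "18 \<le> length ?xs" using card_length[of ?xs] ij by simp
    moreover have "j \<in> set ?xs" using set ij by simp
    ultimately have "\<exists>k. (j, k) \<in> set (zip ?xs (tl ?xs)) \<or> (k, j) \<in> set (zip ?xs (tl ?xs))"
      by (intro ex_zip_tl) auto
    then obtain k where "0 < crossing_gap (line_slope m) (line_intercept \<epsilon>) i j k \<or>
        0 < crossing_gap (line_slope m) (line_intercept \<epsilon>) i k j"
      using gap ij by blast
    then show False using ij(3) by (simp add: crossing_gap_def)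
  qed
  interpret line_family "{..<19}" "line_slope m" "line_offset \<epsilon> m"
    by unfold_locales (use inj in auto)
  show ?thesis
  proof unfold_locales
    fix i :: nat assume "i \<in> {..<19}"
    then have i: "i < 19" by simp
    show "set (crossing_order ! i) = {..<19} - {i}" by (rule set_crossing_order[OF i])
    let ?xs = "crossing_order ! i"
    have tr: "transp (\<lambda>j k. crossing i j < crossing i k)" by (auto intro: transpI)
    have "crossing i (?xs ! n) < crossing i (?xs ! Suc n)" if "Suc n < length ?xs" for n
      unfolding crossing_def line_offset_def
      by (rule crossing_less_if_gap_pos, rule gap[OF i]) (use that in \<open>auto simp: in_set_zip_tl_iff\<close>)
    then show "sorted_wrt (\<lambda>j k. crossing i j < crossing i k) ?xs"
      by (simp add: sorted_wrt_iff_nth_Suc_transp[OF tr])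
  qed
qed

theorem theorem4p1:
  fixes \<epsilon> :: real and m :: "nat \<Rightarrow> real"
  assumes "\<epsilon> \<in> {0 <..< 1 / 10 ^ 4}"
    and "\<forall>i\<in>{1..18}. m i \<in> {slope_center i - 1 / 10 ^ 4 .. slope_center i + 1 / 10 ^ 4}"
  shows "simple_arrangement (arrangement \<epsilon> m) \<and> card (arrangement \<epsilon> m) = 19
    \<and> Y0 = {(x, y). y = 0}
    \<and> (\<forall>i\<in>{1..18}. L \<epsilon> m i = {(x, y). y = m i * (x - intercept \<epsilon> i)})
    \<and> (intercept \<epsilon> ` {1..18} =
         (\<Union>k\<in>{1..8::nat}. {tan (real k * pi / 18), - tan (real k * pi / 18)}) \<union> {- \<epsilon>, \<epsilon>}
       \<and> \<epsilon> < 1 / 36)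
    \<and> card {F \<in> bounded_triangular_faces (arrangement \<epsilon> m). touches Y0 F} = 17
    \<and> card (bounded_triangular_faces (arrangement \<epsilon> m)) = 107"
proof -
  interpret sorted_line_family "{..<19}" "line_slope m" "line_offset \<epsilon> m"
    "(!) crossing_order"
    by (rule sorted_line_family_lines[OF assms])
  have line0: "line 0 = Y0"
    by (auto simp: line_def height_def Y0_def line_slope_def line_offset_def)
  have "line i = L \<epsilon> m i" if "i \<in> {1..18}" for i
    using that
    by (auto simp: line_def height_def L_def line_slope_def line_intercept_def line_offset_def algebra_simps)
  moreover have "{..<19::nat} = insert 0 {1..18}" by auto
  ultimately have arr: "arrangement \<epsilon> m = line ` {..<19}"
    by (simp add: arrangement_def line0)
  have count: "length (triangles_at i) = triangle_count i" for i
    by (simp add: triangles_at_def triangle_count_def)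
  have "card {F \<in> bounded_triangular_faces (arrangement \<epsilon> m). touches Y0 F} = 17"
    \<comment> \<open>The index 0 of \<open>Y0\<close> is the least one, so its row alone gives the
      count.\<close>
    using card_touching_faces[of 0] card_empty_triples_least[of 0]
    by (simp add: arr line0 count triangle_counts)
  moreover have "card (bounded_triangular_faces (arrangement \<epsilon> m)) = 107"
    using triangle_counts(2)
    by (simp only: arr card_bounded_triangular_faces card_empty_triples count
        interv_sum_list_conv_sum_set_nat set_upt atLeast0LessThan)
  moreover have "card (arrangement \<epsilon> m) = 19"
    by (simp add: arr card_image[OF inj_on_line])
  moreover have "intercept \<epsilon> ` {1..18} =
      (\<Union>k\<in>{1..8::nat}. {tan (real k * pi / 18), - tan (real k * pi / 18)}) \<union> {- \<epsilon>, \<epsilon>}"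
  proof -
    have "{1..18} = set [1..<19::nat]" "{1..8} = set [1..<9::nat]" by auto
    then show ?thesis by (simp only:) (auto simp: upt_rec intercept_def)
  qed
  ultimately show ?thesis
    using simple_arrangement_lines assms(1) by (auto simp: arr Y0_def L_def)
qed

end
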